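(* Let $n\ge 2$ be an integer and $c\in\mathbb{R}\setminus\{0\}$. The ordinary differential equation $$y^{(n-1)}(x)+c\,x\,y(x)=0,\qquad x\in\mathbb{C},$$ admits the following $n-1$ linearly independent solutions. (1) If $n$ is odd, or $n$ is even and $c<0$: with $a_k=\cos(2k\pi/n)$ and $b_k=\sin(2k\pi/n)$, the functions $$y_k^+(x)=\int_0^\infty e^{-(-c)^{n-1}\frac{w^n}{n}}\Bigl[e^{-cwx}-e^{-cwxa_k}\cos\Bigl(cwxb_k-\frac{2k\pi}{n}\Bigr)\Bigr]\,dw,\qquad k\in\mathbb{N},\ 1\le k\le \frac n2,$$ $$y_k^-(x)=-\int_0^\infty e^{-(-c)^{n-1}\frac{w^n}{n}-cwxa_k}\sin\Bigl(cwxb_k-\frac{2k\pi}{n}\Bigr)\,dw,\qquad k\in\mathbb{N},\ 1\le k<\frac n2.$$ (2) If $n$ is even and $c>0$: with $a_k=\cos((2k+1)\pi/n)$ and $b_k=\sin((2k+1)\pi/n)$, the functions $$y_k^+(x)=\int_0^\infty e^{-c^{n-1}\frac{w^n}{n}}\Bigl[e^{i\frac{\pi}{n}}e^{-cwxe^{i\pi/n}}-e^{-cwxa_k}\cos\Bigl(cwxb_k-\frac{2k+1}{n}\pi\Bigr)\Bigr]\,dw,\qquad k=1,\dots,\frac n2-1,$$ $$y_k^-(x)=-\int_0^\infty e^{-c^{n-1}\frac{w^n}{n}-cwxa_k}\sin\Bigl(cwxb_k-\frac{2k+1}{n}\pi\Bigr)\,dw,\qquad k=0,\dots,\frac n2-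1.$$
   Context: Here $y^{(j)}$ denotes the $j$-th (complex) derivative of $y:\mathbb{C}\to\mathbb{C}$, and sine and cosine of complex arguments are the usual entire functions. Linear independence is over $\mathbb{C}$. *)

theory Defs
  imports "HOL-Analysis.Analysis" "HOL-Library.Function_Algebras"
begin

text \<open>The complex vector space of all functions from \<open>\<complex>\<close> to \<open>\<complex>\<close>, with pointwise operations;
  it provides linear independence over \<open>\<complex>\<close> as \<open>cfun.independent\<close>.\<close>

global_interpretation cfun: vector_space "\<lambda>(a::complex) (f::complex \<Rightarrow> complex) x. a * f x"
  by unfold_locales (auto simp: fun_eq_iff algebra_simps)

text \<open>Since \<^const>\<open>deriv\<close> is total, differentiability up to the order of the equation is required
  explicitly.\<close>

definition ode_solution :: "nat \<Rightarrow> real \<Rightarrow> (complex \<Rightarrow> complex) \<Rightarrow> bool" where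
  "ode_solution n c y \<longleftrightarrow>
     (\<forall>j<n - 1. \<forall>x. (deriv ^^ j) y field_differentiable at x) \<and>
     (\<forall>x. (deriv ^^ (n - 1)) y x + of_real c * x * y x = 0)"

text \<open>The integrands are separate constants so that convergence of the integrals can be stated:
  the Lebesgue integral of a non-integrable function is 0 by convention.\<close>

definition integrand1_plus :: "nat \<Rightarrow> real \<Rightarrow> nat \<Rightarrow> complex \<Rightarrow> real \<Rightarrow> complex" where
  "integrand1_plus n c k x w =
     (let a = cos (2 * real k * pi / real n); b = sin (2 * real k * pi / real n) in
      of_real (exp (- ((- c) ^ (n - 1) * (w ^ n / real n)))) *
      (exp (- (of_real (c * w) * x))
       - exp (- (of_real (c * w) * x * of_real a))
         * cos (of_real (c * w) * x * of_real b - of_real (2 * real k * pi / real n))))"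

definition integrand1_minus :: "nat \<Rightarrow> real \<Rightarrow> nat \<Rightarrow> complex \<Rightarrow> real \<Rightarrow> complex" where
  "integrand1_minus n c k x w =
     (let a = cos (2 * real k * pi / real n); b = sin (2 * real k * pi / real n) in
      exp (- of_real ((- c) ^ (n - 1) * (w ^ n / real n)) - of_real (c * w) * x * of_real a)
      * sin (of_real (c * w) * x * of_real b - of_real (2 * real k * pi / real n)))"

definition integrand2_plus :: "nat \<Rightarrow> real \<Rightarrow> nat \<Rightarrow> complex \<Rightarrow> real \<Rightarrow> complex" where
  "integrand2_plus n c k x w =
     (let a = cos ((2 * real k + 1) * pi / real n); b = sin ((2 * real k + 1) * pi / real n) in
      of_real (exp (- (c ^ (n - 1) * (w ^ n / real n)))) *
      (exp (\<i> * of_real (pi / real n))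
         * exp (- (of_real (c * w) * x * exp (\<i> * of_real (pi / real n))))
       - exp (- (of_real (c * w) * x * of_real a))
         * cos (of_real (c * w) * x * of_real b - of_real ((2 * real k + 1) / real n * pi))))"

definition integrand2_minus :: "nat \<Rightarrow> real \<Rightarrow> nat \<Rightarrow> complex \<Rightarrow> real \<Rightarrow> complex" where
  "integrand2_minus n c k x w =
     (let a = cos ((2 * real k + 1) * pi / real n); b = sin ((2 * real k + 1) * pi / real n) in
      exp (- of_real (c ^ (n - 1) * (w ^ n / real n)) - of_real (c * w) * x * of_real a)
      * sin (of_real (c * w) * x * of_real b - of_real ((2 * real k + 1) / real n * pi)))"

definition y1_plus :: "nat \<Rightarrow> real \<Rightarrow> nat \<Rightarrow> complex \<Rightarrow> complex" where
  "y1_plus n c k x = (LBINT w:{0..}. integrand1_plus n c k x w)"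

definition y1_minus :: "nat \<Rightarrow> real \<Rightarrow> nat \<Rightarrow> complex \<Rightarrow> complex" where
  "y1_minus n c k x = - (LBINT w:{0..}. integrand1_minus n c k x w)"

definition y2_plus :: "nat \<Rightarrow> real \<Rightarrow> nat \<Rightarrow> complex \<Rightarrow> complex" where
  "y2_plus n c k x = (LBINT w:{0..}. integrand2_plus n c k x w)"

definition y2_minus :: "nat \<Rightarrow> real \<Rightarrow> nat \<Rightarrow> complex \<Rightarrow> complex" where
  "y2_minus n c k x = - (LBINT w:{0..}. integrand2_minus n c k x w)"

definition index1_plus :: "nat \<Rightarrow> nat set" where
  "index1_plus n = {k. 1 \<le> k \<and> real k \<le> real n / 2}"

definition index1_minus :: "nat \<Rightarrow> nat set" where
  "index1_minus n = {k. 1 \<le> k \<and> real k < real n / 2}"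

text \<open>The following two are only used for even \<open>n \<ge> 2\<close>, so neither division nor subtraction
  truncates.\<close>

definition index2_plus :: "nat \<Rightarrow> nat set" where
  "index2_plus n = {1..n div 2 - 1}"

definition index2_minus :: "nat \<Rightarrow> nat set" where
  "index2_minus n = {0..n div 2 - 1}"

definition solutions1 :: "nat \<Rightarrow> real \<Rightarrow> (complex \<Rightarrow> complex) set" where
  "solutions1 n c = y1_plus n c ` index1_plus n \<union> y1_minus n c ` index1_minus n"

definition solutions2 :: "nat \<Rightarrow> real \<Rightarrow> (complex \<Rightarrow> complex) set" where
  "solutions2 n c = y2_plus n c ` index2_plus n \<union> y2_minus n c ` index2_minus n"

end

theory Submission
  imports Defs "HOL-Computational_Algebra.Polynomial"
begin

text \<open>
  For \<open>A > 0\<close> and a complex direction \<open>z\<close> with \<open>z ^ n * (- c) ^ (n - 1) = A\<close>, integration by parts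
  shows that \<open>g z x = z * \<integral>\<^sub>0\<^sup>\<infinity> exp (- A w ^ n / n - c w x z) dw\<close> satisfies
  \<open>g\<^bsup>(n-1)\<^esup> + c x g = 1\<close>, whence every combination of the \<open>g z\<close> whose coefficients have sum zero
  solves the homogeneous equation. The functions of the theorem are such combinations: by Euler's formula
  the cosine and sine are the even and odd parts of \<open>g\<close> under conjugation of the direction.
  The \<open>j\<close>-th derivative of \<open>g z\<close> at \<open>0\<close> is \<open>z ^ (j + 1)\<close> times a nonzero factor that does
  not depend on \<open>z\<close>, so interpolation by polynomials makes the \<open>g z\<close> linearly independent.
\<close>

section \<open>Elementary bounds for the exponential\<close>

lemma set_integrable_exp_minus: "set_integrable lborel {0..} (\<lambda>w::real. exp (- w))"
proof -
  have "(\<lambda>w::real. exp (- w)) absolutely_integrable_on {0..}"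
    using integrable_on_exp_minus_to_infinity[of 1 0]
    by (intro nonnegative_absolutely_integrable_1) auto
  then show ?thesis
    unfolding set_integrable_def
    by (subst (asm) integrable_completion)
       (auto intro!: borel_measurable_continuous_on_indicator continuous_intros)
qed

text \<open>The Taylor remainder of order two; it will control the error of linearising
  \<open>exp (- (s * w))\<close> in \<open>s\<close>.\<close>

lemma norm_exp_minus_linear_le:
  fixes z :: complex
  shows "norm (exp z - 1 - z) \<le> (norm z)\<^sup>2 * exp (norm z)"
  using Taylor_exp_field[of z 1] by (simp add: power2_eq_square algebra_simps)

section \<open>Moments of the weight \<open>exp (- A w ^ n / n)\<close> and their identities\<close>

locale exp_moment =
  fixes n :: nat and A :: real
  assumes n2: "2 \<le> n" and A_pos: "0 < A"
begin

definition kern :: "nat \<Rightarrow> complex \<Rightarrow> real \<Rightarrow> complex" where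
  "kern m s w = of_real (w ^ m * exp (- (A * (w ^ n / real n)))) * exp (- (s * of_real w))"

text \<open>This is the Laplace transform at \<open>s\<close> of the weight times
  \<open>w ^ m\<close>, hence up to the sign \<open>(- 1) ^ m\<close> the \<open>m\<close>-th
  derivative of \<open>moment 0\<close>.\<close>

definition moment :: "nat \<Rightarrow> complex \<Rightarrow> complex" where
  "moment m s = (LBINT w:{0..}. kern m s w)"

text \<open>Completing the square, since \<open>w ^ n \<ge> w\<^sup>2 - 1\<close>.\<close>

lemma weight_le:
  fixes w r :: real
  assumes "0 \<le> w"
  shows "exp (- (A * (w ^ n / real n))) * exp (r * w)
           \<le> exp (A / n + (r + 1)\<^sup>2 * n / (4 * A)) * exp (- w)"
proof -
  have n0: "0 < real n" using n2 by simp
  have "w ^ n \<ge> w\<^sup>2 - 1"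
  proof (cases "w \<le> 1")
    case True
    then have "w\<^sup>2 \<le> 1" using assms by (simp add: power_le_one)
    moreover have "0 \<le> w ^ n" using assms by simp
    ultimately show ?thesis by linarith
  next
    case False
    then have "w\<^sup>2 \<le> w ^ n" using n2 by (intro power_increasing) auto
    then show ?thesis by simp
  qed
  then have "A / n * (w\<^sup>2 - 1) \<le> A / n * w ^ n"
    using A_pos n0 by (intro mult_left_mono) auto
  moreover have "0 \<le> A / n * (w - (r + 1) * n / (2 * A))\<^sup>2"
    using A_pos n0 by simp
  moreover have "A / n * (w - (r + 1) * n / (2 * A))\<^sup>2
      = A / n * w\<^sup>2 - (r + 1) * w + (r + 1)\<^sup>2 * n / (4 * A)"
    using A_pos n0 by (simp add: field_simps power2_eq_square)
  ultimately have "- (A * (w ^ n / real n)) + r * w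
      \<le> A / n + (r + 1)\<^sup>2 * n / (4 * A) + - w"
    by (simp add: algebra_simps)
  then show ?thesis
    by (simp only: exp_add [symmetric] exp_le_cancel_iff)
qed

text \<open>Since \<open>w \<le> exp w\<close>, the power \<open>w ^ m\<close> is absorbed into
  \<open>exp (m * w)\<close>, and \<open>weight_le\<close> applies with
  \<open>r = m + norm s\<close>. The bound yields both integrability and decay at infinity.\<close>

lemma norm_kern_le:
  assumes "0 \<le> w"
  shows "norm (kern m s w)
           \<le> exp (A / n + (real m + norm s + 1)\<^sup>2 * n / (4 * A)) * exp (- w)"
proof -
  have "w ^ m \<le> exp w ^ m"
    using assms exp_ge_add_one_self[of w] by (intro power_mono) linarith+
  then have m: "w ^ m \<le> exp (real m * w)" by (simp add: exp_of_nat_mult)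
  have "- Re (s * of_real w) \<le> norm s * w"
    using complex_Re_le_cmod[of "- s"] assms mult_right_mono[of "- Re s" "norm s" w] by simp
  then have s: "norm (exp (- (s * of_real w))) \<le> exp (norm s * w)" by simp
  have "norm (kern m s w)
      = w ^ m * exp (- (A * (w ^ n / real n))) * norm (exp (- (s * of_real w)))"
    using assms by (simp add: kern_def norm_mult norm_power)
  also have "\<dots> \<le> exp (real m * w) * exp (- (A * (w ^ n / real n))) * exp (norm s * w)"
    using assms m s by (intro mult_mono) auto
  also have "\<dots> = exp (- (A * (w ^ n / real n))) * exp ((real m + norm s) * w)"
    by (simp add: exp_add [symmetric] algebra_simps)
  also have "\<dots> \<le> exp (A / n + (real m + norm s + 1)\<^sup>2 * n / (4 * A)) * exp (- w)"
    by (rule weight_le[OF assms])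
  finally show ?thesis .
qed

lemma continuous_on_kern [continuous_intros]: "continuous_on S (kern m s)"
  unfolding kern_def by (intro continuous_intros) (use n2 in auto)

lemma set_integrable_kern: "set_integrable lborel {0..} (kern m s)"
proof (rule set_integrable_bound)
  show "set_integrable lborel {0..}
      (\<lambda>w. exp (A / n + (real m + norm s + 1)\<^sup>2 * n / (4 * A)) * exp (- w))"
    using set_integrable_exp_minus by simp
  show "set_borel_measurable lborel {0..} (kern m s)"
    unfolding set_borel_measurable_def
    by (auto intro!: borel_measurable_continuous_on_indicator continuous_intros)
qed (use norm_kern_le in auto)

text \<open>The left side is \<open>kern m s w\<close> times the Taylor remainder of
  \<open>exp\<close> at \<open>- h * w\<close>. As \<open>norm h \<le> 1\<close>, its growth is at
  most \<open>exp ((norm s + 1) * w)\<close>; writing this as a kernel at a negative real argument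
  gives an integrable majorant independent of \<open>h\<close>.\<close>

lemma norm_kern_diff_le:
  assumes "0 \<le> w" "norm h \<le> 1"
  shows "norm (kern m (s + h) w - kern m s w + h * kern (Suc m) s w)
           \<le> (norm h)\<^sup>2 * norm (kern (m + 2) (- of_real (norm s + 1)) w)"
proof -
  define z where "z = - (h * of_real w)"
  have nz: "norm z = norm h * w" using assms by (simp add: z_def norm_mult)
  have "kern m (s + h) w - kern m s w + h * kern (Suc m) s w = kern m s w * (exp z - 1 - z)"
    by (simp add: kern_def z_def algebra_simps exp_diff exp_minus field_simps)
  then have "norm (kern m (s + h) w - kern m s w + h * kern (Suc m) s w)
      = norm (kern m s w) * norm (exp z - 1 - z)"
    by (simp add: norm_mult)
  also have "\<dots> \<le> norm (kern m s w) * ((norm h * w)\<^sup>2 * exp (norm h * w))"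
    using norm_exp_minus_linear_le[of z] nz by (intro mult_left_mono) auto
  also have "norm (kern m s w)
      = w ^ m * exp (- (A * (w ^ n / real n))) * exp (- (Re s * w))"
    using assms by (simp add: kern_def norm_mult norm_power)
  also have "w ^ m * exp (- (A * (w ^ n / real n))) * exp (- (Re s * w))
        * ((norm h * w)\<^sup>2 * exp (norm h * w))
      = (norm h)\<^sup>2 * (w ^ (m + 2) * exp (- (A * (w ^ n / real n)))
        * exp ((norm h - Re s) * w))"
    by (simp add: power_mult_distrib power_add exp_add [symmetric] algebra_simps
        power2_eq_square exp_diff exp_minus field_simps)
  also have "\<dots> \<le> (norm h)\<^sup>2 * (w ^ (m + 2) * exp (- (A * (w ^ n / real n)))
        * exp ((norm s + 1) * w))"
  proof -
    have "norm h - Re s \<le> norm s + 1"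
      using assms abs_Re_le_cmod[of s] by linarith
    then show ?thesis
      using assms by (intro mult_left_mono) (auto intro!: mult_right_mono)
  qed
  also have "w ^ (m + 2) * exp (- (A * (w ^ n / real n))) * exp ((norm s + 1) * w)
      = norm (kern (m + 2) (- of_real (norm s + 1)) w)"
    using assms by (simp add: kern_def norm_mult norm_power algebra_simps)
  finally show ?thesis .
qed

text \<open>Differentiation under the integral sign: integrating the quadratic bound on the kernels
  and dividing by \<open>h\<close> leaves an error of at most \<open>norm h * B\<close>.\<close>

lemma has_field_derivative_moment:
  "(moment m has_field_derivative - moment (Suc m) s) (at s)"
proof -
  define B where "B = (LBINT w:{0..}. norm (kern (m + 2) (- of_real (norm s + 1)) w))"
  have bnd: "norm (moment m (s + h) - moment m s + h * moment (Suc m) s) \<le> (norm h)\<^sup>2 * B"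
    if h: "norm h \<le> 1" for h
  proof -
    have int: "set_integrable lborel {0..}
        (\<lambda>w. kern m (s + h) w - kern m s w + h * kern (Suc m) s w)"
      by (intro set_integral_add set_integral_diff set_integrable_mult_right set_integrable_kern)
    have "moment m (s + h) - moment m s + h * moment (Suc m) s
        = (LBINT w:{0..}. kern m (s + h) w - kern m s w + h * kern (Suc m) s w)"
      unfolding moment_def
      by (subst set_integral_add set_integral_diff set_integral_mult_right,
          (intro set_integral_add set_integral_diff set_integrable_mult_right set_integrable_kern)+)+
         simp
    also have "norm \<dots>
        \<le> (LBINT w:{0..}. norm (kern m (s + h) w - kern m s w + h * kern (Suc m) s w))"
      by (rule set_integral_norm_bound[OF int])
    also have "\<dots>
        \<le> (LBINT w:{0..}. (norm h)\<^sup>2 * norm (kern (m + 2) (- of_real (norm s + 1)) w))"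
      using h by (intro set_integral_mono set_integrable_norm int set_integrable_mult_right
          set_integrable_kern norm_kern_diff_le) auto
    finally show ?thesis by (simp add: B_def)
  qed
  have "((\<lambda>h. norm h * B) \<longlongrightarrow> 0) (at (0::complex))"
    by (auto intro!: tendsto_eq_intros)
  then have "((\<lambda>h. (moment m (s + h) - moment m s) / h - - moment (Suc m) s) \<longlongrightarrow> 0) (at 0)"
  proof (rule Lim_null_comparison[rotated])
    have "\<forall>\<^sub>F h in at (0::complex). norm h \<le> 1 \<and> h \<noteq> 0"
      by (auto simp: eventually_at intro!: exI[of _ 1])
    then show "\<forall>\<^sub>F h in at 0.
        norm ((moment m (s + h) - moment m s) / h - - moment (Suc m) s) \<le> norm h * B"
    proof eventually_elim
      case (elim h)
      then have "(moment m (s + h) - moment m s) / h - - moment (Suc m) s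
          = (moment m (s + h) - moment m s + h * moment (Suc m) s) / h"
        by (simp add: field_simps)
      then show ?case
        using bnd[of h] elim
        by (simp add: norm_divide divide_le_eq power2_eq_square mult_ac)
    qed
  qed
  then show ?thesis
    unfolding DERIV_def by (subst Lim_null) simp
qed

text \<open>The combined integrand is the exact derivative of \<open>- kern 0 s\<close>, so only the
  boundary values 1 at zero and 0 at infinity remain.\<close>

lemma moment_ode: "of_real A * moment (n - 1) s + s * moment 0 s = 1"
proof -
  define f where "f w = of_real A * kern (n - 1) s w + s * kern 0 s w" for w
  have int: "set_integrable lborel {0..} f"
    unfolding f_def by (intro set_integral_add set_integrable_mult_right set_integrable_kern)
  \<comment> \<open>\<open>A * w ^ (n - 1) + s\<close> is the derivative of the negated exponent
    \<open>A * w ^ n / n + s * w\<close>. The complex derivative is restricted to the real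
    line.\<close>
  have f: "((\<lambda>w. - kern 0 s w) has_vector_derivative f w) (at w within X)" for w X
  proof -
    have "((\<lambda>z. - (exp (- (of_real A * (z ^ n / of_nat n)) - s * z)))
        has_field_derivative
          (of_real A * of_real w ^ (n - 1) + s)
            * exp (- (of_real A * (of_real w ^ n / of_nat n)) - s * of_real w))
        (at (of_real w))"
      using n2 by (auto intro!: derivative_eq_intros simp: algebra_simps)
    from has_vector_derivative_real_field[OF this]
    show ?thesis
      by (simp add: f_def kern_def exp_of_real [symmetric] exp_add [symmetric] exp_diff exp_minus
          field_simps)
  qed
  \<comment> \<open>The half-line is exhausted by compact intervals, on which the fundamental
    theorem of calculus applies.\<close>
  have "(\<lambda>i. LBINT w:{0..real i}. f w) \<longlonglongrightarrow> (LBINT w:(\<Union>i. {0..real i}). f w)"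
  proof (rule set_integral_cont_up)
    show "incseq (\<lambda>i. {0..real i})" by (auto simp: incseq_def)
    show "set_integrable lborel (\<Union>i. {0..real i}) f"
      by (rule set_integrable_subset[OF int]) auto
  qed auto
  moreover have "(\<Union>i. {0..real i}) = {0..}"
    by (auto simp: real_arch_simple)
  moreover have "(LBINT w:{0..real i}. f w) = 1 - kern 0 s (real i)" for i
  proof -
    have "continuous_on {0..real i} f"
      unfolding f_def by (intro continuous_intros)
    then show ?thesis
      unfolding set_lebesgue_integral_def
      by (subst integral_FTC_atLeastAtMost[OF _ f]) (use n2 in \<open>auto simp: kern_def\<close>)
  qed
  ultimately have lim: "(\<lambda>i. 1 - kern 0 s (real i)) \<longlonglongrightarrow> (LBINT w:{0..}. f w)"
    by simp
  have "(\<lambda>i. exp (- real i)) \<longlonglongrightarrow> 0"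
    by (intro filterlim_compose[OF exp_at_bot] filterlim_uminus_at_bot_at_top
        filterlim_compose[OF filterlim_uminus_at_bot_at_top filterlim_real_sequentially])
  then have "(\<lambda>i. exp (A / n + (real 0 + norm s + 1)\<^sup>2 * n / (4 * A)) * exp (- real i)) \<longlonglongrightarrow> 0"
    by (rule tendsto_mult_right_zero)
  then have "(\<lambda>i. kern 0 s (real i)) \<longlonglongrightarrow> 0"
    by (rule Lim_null_comparison[rotated])
       (intro always_eventually allI norm_kern_le of_nat_0_le_iff)
  then have "(\<lambda>i. 1 - kern 0 s (real i)) \<longlonglongrightarrow> 1 - 0"
    by (intro tendsto_intros)
  with lim have "(LBINT w:{0..}. f w) = 1"
    using LIMSEQ_unique by fastforce
  then show ?thesis
    unfolding f_def moment_def
    by (subst (asm) set_integral_add)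
       (auto intro!: set_integrable_mult_right set_integrable_kern)
qed

text \<open>At \<open>s = 0\<close> the integrand is real and nonnegative, and on
  \<open>{1..2}\<close>, an interval of length 1, it is at least \<open>e > 0\<close>. Hence the
  integral is at least \<open>e\<close>.\<close>

lemma moment_0_nonzero: "moment m 0 \<noteq> 0"
proof -
  define e where "e = exp (- (A * (2 ^ n / real n)))"
  have le: "indicator {1..2} w * e \<le> indicator {0..} w * (w ^ m * exp (- (A * (w ^ n / real n))))"
    for w :: real
  proof (cases "w \<in> {1..2}")
    case True
    then have "w ^ n \<le> 2 ^ n" by (intro power_mono) auto
    then have "e \<le> exp (- (A * (w ^ n / real n)))"
      using A_pos by (auto simp: e_def intro!: mult_left_mono divide_right_mono)
    moreover have "1 \<le> w ^ m" using True by simp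
    ultimately have "1 * e \<le> w ^ m * exp (- (A * (w ^ n / real n)))"
      by (intro mult_mono) (auto simp: e_def)
    with True show ?thesis by simp
  qed (auto simp: indicator_def)
  have int: "set_integrable lborel {0..} (\<lambda>w. w ^ m * exp (- (A * (w ^ n / real n))))"
    using set_integrable_kern[of m 0]
    unfolding kern_def set_integrable_def
    by (simp add: complex_of_real_integrable_eq [symmetric] scaleR_conv_of_real
        flip: of_real_mult)
  have "e = (LBINT w. indicator {1..2::real} w * e)"
    by simp
  also have "\<dots> \<le> (LBINT w. indicator {0..} w * (w ^ m * exp (- (A * (w ^ n / real n)))))"
    using int le by (intro integral_mono) (auto simp: set_integrable_def)
  finally have "0 < (LBINT w:{0..}. w ^ m * exp (- (A * (w ^ n / real n))))"
    by (simp add: set_lebesgue_integral_def e_def less_le_trans[OF exp_gt_zero])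
  moreover have "moment m 0 = of_real (LBINT w:{0..}. w ^ m * exp (- (A * (w ^ n / real n))))"
    by (simp add: moment_def kern_def flip: set_integral_complex_of_real)
  ultimately show ?thesis by simp
qed

end

section \<open>The inhomogeneous equation along a ray, and independence of rays\<close>

locale airy_ode = exp_moment +
  fixes c :: real
  assumes c_nonzero: "c \<noteq> 0"
begin

definition ray_integrand :: "complex \<Rightarrow> complex \<Rightarrow> real \<Rightarrow> complex" where
  "ray_integrand z x w = z * kern 0 (of_real c * z * x) w"

text \<open>\<open>ray 0 z\<close> is the function \<open>g z\<close> of the introduction, and
  \<open>ray j z\<close> is its \<open>j\<close>-th derivative in closed form; each differentiation
  contributes a factor \<open>- (c * z)\<close> by the chain rule.\<close>

definition ray :: "nat \<Rightarrow> complex \<Rightarrow> complex \<Rightarrow> complex" where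
  "ray j z x = z * (- (of_real c * z)) ^ j * moment j (of_real c * z * x)"

text \<open>Isolating \<open>z ^ (j + 1)\<close> serves twice: for \<open>j = n - 1\<close> the
  power is \<open>z ^ n\<close>, and at \<open>x = 0\<close> the remaining factor is the same for
  all directions.\<close>

lemma ray_altdef: "ray j z x = (- of_real c) ^ j * (z * z ^ j) * moment j (of_real c * z * x)"
proof -
  have "(- (of_real c * z)) ^ j = (- of_real c) ^ j * z ^ j"
    by (simp flip: power_mult_distrib)
  then show ?thesis by (simp only: ray_def mult_ac)
qed

lemma set_integrable_ray_integrand [intro]: "set_integrable lborel {0..} (ray_integrand z x)"
  unfolding ray_integrand_def by (intro set_integrable_mult_right set_integrable_kern)

lemma integral_ray_integrand: "(LBINT w:{0..}. ray_integrand z x w) = ray 0 z x"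
  by (simp add: ray_integrand_def ray_def moment_def)

lemma has_field_derivative_ray [derivative_intros]:
  "(ray j z has_field_derivative ray (Suc j) z x) (at x)"
proof -
  have "((\<lambda>x. moment j (of_real c * z * x)) has_field_derivative
      - moment (Suc j) (of_real c * z * x) * (of_real c * z)) (at x)"
    by (rule DERIV_chain2[OF has_field_derivative_moment DERIV_cmult_Id])
  from DERIV_cmult[OF this, of "z * (- (of_real c * z)) ^ j"]
  show ?thesis
    unfolding ray_def by (rule DERIV_cong) simp
qed

lemma has_field_derivative_sum_ray:
  "((\<lambda>x. \<Sum>z\<in>\<Omega>. v z * ray j z x) has_field_derivative (\<Sum>z\<in>\<Omega>. v z * ray (Suc j) z x)) (at x)"
  by (intro DERIV_sum DERIV_cmult has_field_derivative_ray)

lemma deriv_sum_ray: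
  "(deriv ^^ j) (\<lambda>x. \<Sum>z\<in>\<Omega>. v z * ray 0 z x) = (\<lambda>x. \<Sum>z\<in>\<Omega>. v z * ray j z x)"
proof (induction j)
  case (Suc j)
  then show ?case
    by (simp add: Suc.IH) (intro ext DERIV_imp_deriv has_field_derivative_sum_ray)
qed simp

lemma ode_solution_sum_ray:
  assumes \<Omega>: "\<And>z. z \<in> \<Omega> \<Longrightarrow> z ^ n * (- of_real c) ^ (n - 1) = of_real A"
    and v: "(\<Sum>z\<in>\<Omega>. v z) = 0"
  shows "ode_solution n c (\<lambda>x. \<Sum>z\<in>\<Omega>. v z * ray 0 z x)"
proof -
  \<comment> \<open>The assumption on \<open>z ^ n\<close> turns the leading factor into
    \<open>A\<close>; the claim is then \<open>moment_ode\<close> at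
    \<open>s = c * z * x\<close>.\<close>
  have ray: "ray (n - 1) z x + of_real c * x * ray 0 z x = 1" if "z \<in> \<Omega>" for z x
  proof -
    have "z * z ^ (n - 1) = z ^ n"
      using n2 by (simp flip: power_Suc)
    then have "ray (n - 1) z x = of_real A * moment (n - 1) (of_real c * z * x)"
      unfolding ray_altdef using \<Omega>[OF that] by (simp only: mult.commute)
    moreover have "ray 0 z x = z * moment 0 (of_real c * z * x)"
      by (simp add: ray_def)
    ultimately show ?thesis
      using moment_ode[of "of_real c * z * x"] by (simp only: mult_ac)
  qed
  have "(\<Sum>z\<in>\<Omega>. v z * ray (n - 1) z x) + of_real c * x * (\<Sum>z\<in>\<Omega>. v z * ray 0 z x) = 0" for x
  proof -
    have "(\<Sum>z\<in>\<Omega>. v z * ray (n - 1) z x) + of_real c * x * (\<Sum>z\<in>\<Omega>. v z * ray 0 z x)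
        = (\<Sum>z\<in>\<Omega>. v z * (ray (n - 1) z x + of_real c * x * ray 0 z x))"
      unfolding sum_distrib_left sum.distrib [symmetric]
      by (intro sum.cong refl) (simp only: distrib_left mult_ac)
    also have "\<dots> = (\<Sum>z\<in>\<Omega>. v z)"
      by (intro sum.cong refl) (simp only: ray mult_1_right)
    finally show ?thesis using v by simp
  qed
  moreover have "(\<lambda>x. \<Sum>z\<in>\<Omega>. v z * ray j z x) field_differentiable at x" for j x
    unfolding field_differentiable_def
    using has_field_derivative_sum_ray by blast
  ultimately show ?thesis
    by (simp add: ode_solution_def deriv_sum_ray)
qed

text \<open>A Vandermonde argument: the derivatives at 0 annihilate every power of \<open>z\<close>,
  hence every polynomial, in particular one that vanishes at all directions but
  \<open>a\<close>.\<close>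

lemma sum_ray_eq_0D:
  assumes "finite \<Omega>" "0 \<notin> \<Omega>"
    and sum: "\<And>x. (\<Sum>z\<in>\<Omega>. v z * ray 0 z x) = 0"
    and "a \<in> \<Omega>"
  shows "v a = 0"
proof -
  \<comment> \<open>At \<open>x = 0\<close> all moments have argument 0, so the nonzero factor
    \<open>(- c) ^ j * moment j 0\<close> is common to the sum and can be cancelled.\<close>
  have mono: "(\<Sum>z\<in>\<Omega>. v z * z * z ^ j) = 0" for j
  proof -
    have "(\<lambda>x. \<Sum>z\<in>\<Omega>. v z * ray j z x) = (deriv ^^ j) (\<lambda>x. 0)"
      unfolding deriv_sum_ray[of j v \<Omega>, symmetric] by (simp only: sum)
    also have "\<dots> = (\<lambda>x. 0)"
      by (induction j) simp_all
    finally have "(\<Sum>z\<in>\<Omega>. v z * ray j z 0) = 0"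
      by (rule fun_cong)
    moreover have "(\<Sum>z\<in>\<Omega>. v z * ray j z 0)
        = ((- of_real c) ^ j * moment j 0) * (\<Sum>z\<in>\<Omega>. v z * z * z ^ j)"
      unfolding sum_distrib_left by (intro sum.cong) (simp_all add: ray_altdef)
    ultimately show ?thesis
      using c_nonzero moment_0_nonzero[of j] by simp
  qed
  have poly: "(\<Sum>z\<in>\<Omega>. v z * z * poly q z) = 0" for q
  proof -
    have "(\<Sum>z\<in>\<Omega>. v z * z * poly q z)
        = (\<Sum>i\<le>degree q. coeff q i * (\<Sum>z\<in>\<Omega>. v z * z * z ^ i))"
      unfolding poly_altdef sum_distrib_left
      by (subst sum.swap) (simp add: mult_ac)
    then show ?thesis by (simp add: mono)
  qed
  \<comment> \<open>The Lagrange polynomial at \<open>a\<close>, left without normalisation.\<close>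
  define q where "q = (\<Prod>b\<in>\<Omega> - {a}. [:- b, 1:])"
  have q: "poly q z = (\<Prod>b\<in>\<Omega> - {a}. z - b)" for z
    by (simp add: q_def poly_prod)
  have "(\<Sum>z\<in>\<Omega> - {a}. v z * z * poly q z) = 0"
    using assms(1) by (intro sum.neutral) (simp add: q)
  then have "(\<Sum>z\<in>\<Omega>. v z * z * poly q z) = v a * a * poly q a"
    using sum.remove[OF assms(1,4), of "\<lambda>z. v z * z * poly q z"] by simp
  moreover have "poly q a \<noteq> 0"
    using assms(1) by (auto simp: q)
  ultimately show ?thesis
    using poly[of q] assms(2,4) by auto
qed

end

section \<open>Linear independence of indexed families\<close>

text \<open>Equal values at two indices would give a relation with coefficients 1 and - 1.
  Injectivity is recorded because it determines the number of solutions.\<close>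

lemma (in vector_space) independent_image_if_scalars_zero:
  assumes "finite I"
    and zero: "\<And>u i. (\<Sum>i\<in>I. scale (u i) (f i)) = 0 \<Longrightarrow> i \<in> I \<Longrightarrow> u i = 0"
  shows "inj_on f I" "independent (f ` I)"
proof -
  show inj: "inj_on f I"
  proof (rule inj_onI, rule ccontr)
    fix i j assume ij: "i \<in> I" "j \<in> I" "f i = f j" "i \<noteq> j"
    define u :: "_ \<Rightarrow> 'a" where "u k = (if k = i then 1 else if k = j then - 1 else 0)" for k
    have "(\<Sum>k\<in>I. scale (u k) (f k)) = (\<Sum>k\<in>{i, j}. scale (u k) (f k))"
      using assms(1) ij by (intro sum.mono_neutral_right) (auto simp: u_def)
    also have "\<dots> = 0" using ij by (simp add: u_def)
    finally show False using zero[of u i] ij by (simp add: u_def)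
  qed
  show "independent (f ` I)"
  proof (rule independent_if_scalars_zero)
    fix u x assume "(\<Sum>x\<in>f ` I. scale (u x) x) = 0" "x \<in> f ` I"
    then show "u x = 0"
      using zero[of "u \<circ> f"] by (auto simp: sum.reindex[OF inj])
  qed (use assms in simp)
qed

lemma sum_fun_apply: "(\<Sum>i\<in>I. f i) x = (\<Sum>i\<in>I. f i x)"
  by (induction I rule: infinite_finite_induct) auto

section \<open>Euler's formula for a pair of conjugate directions\<close>

text \<open>Replacing \<open>t\<close> by \<open>- t\<close> keeps the first factor and inverts the
  second, so cosine and sine arise as half sum and half difference.\<close>

lemma cis_mult_exp:
  "cis t * exp (- (u * cis t)) = exp (- (u * of_real (cos t))) * exp (- (\<i> * (u * of_real (sin t) - of_real t)))"
proof -
  have "cis t = of_real (cos t) + \<i> * of_real (sin t)"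
    by (simp add: complex_eq_iff)
  then have "exp (- (u * cis t)) = exp (- (u * of_real (cos t)) - \<i> * (u * of_real (sin t)))"
    by (simp add: algebra_simps)
  then show ?thesis
    by (simp add: cis_conv_exp exp_add [symmetric] algebra_simps)
qed

lemma exp_mult_cos_eq:
  "exp (- (u * of_real (cos t))) * cos (u * of_real (sin t) - of_real t)
     = (cis t * exp (- (u * cis t)) + cis (- t) * exp (- (u * cis (- t)))) / 2"
  unfolding cis_mult_exp cos_exp_eq by (simp add: algebra_simps)

text \<open>The direction \<open>cis t\<close> carries the phase with negative sign, whence the
  outer minus; it cancels the one in \<open>y1_minus\<close> and \<open>y2_minus\<close>.\<close>

lemma exp_mult_sin_eq:
  "exp (- (u * of_real (cos t))) * sin (u * of_real (sin t) - of_real t)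
     = - ((cis t * exp (- (u * cis t)) - cis (- t) * exp (- (u * cis (- t)))) / (2 * \<i>))"
  unfolding cis_mult_exp sin_exp_eq by (simp add: algebra_simps diff_divide_distrib)

section \<open>Solutions built from conjugate pairs of directions\<close>

text \<open>The angles \<open>\<phi> k\<close> and \<open>- \<phi> k\<close> run through the directions \<open>z\<close> with \<open>z ^ n = \<plusminus>1\<close> along
  which \<open>ray\<close> solves the inhomogeneous equation with right-hand side 1.\<close>

locale airy_ode_angles = airy_ode +
  fixes \<phi> :: "nat \<Rightarrow> real" and P Q :: "nat set"
  assumes finite_P: "finite P" and finite_Q: "finite Q"
    and pos_P: "0 \<notin> P"
    and inj_\<phi>: "inj_on \<phi> (insert 0 (P \<union> Q))"
    and \<phi>_range: "k \<in> insert 0 (P \<union> Q) \<Longrightarrow> \<phi> k \<in> {0..pi}"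
    and \<phi>_interior: "k \<in> Q \<Longrightarrow> \<phi> k \<in> {0<..<pi}"
    and direction: "cis (of_nat n * \<phi> k) * (- of_real c) ^ (n - 1) = of_real A"
begin

definition directions :: "complex set" where
  "directions = (\<lambda>k. cis (\<phi> k)) ` insert 0 (P \<union> Q) \<union> (\<lambda>k. cis (- \<phi> k)) ` insert 0 (P \<union> Q)"

definition coeff_plus :: "nat \<Rightarrow> complex \<Rightarrow> complex" where
  "coeff_plus k z = of_bool (z = cis (\<phi> 0))
     - (of_bool (z = cis (\<phi> k)) + of_bool (z = cis (- \<phi> k))) / 2"

definition coeff_minus :: "nat \<Rightarrow> complex \<Rightarrow> complex" where
  "coeff_minus k z = (of_bool (z = cis (\<phi> k)) - of_bool (z = cis (- \<phi> k))) / (2 * \<i>)"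

definition sol_plus :: "nat \<Rightarrow> complex \<Rightarrow> complex" where
  "sol_plus k x = ray 0 (cis (\<phi> 0)) x - (ray 0 (cis (\<phi> k)) x + ray 0 (cis (- \<phi> k)) x) / 2"

definition sol_minus :: "nat \<Rightarrow> complex \<Rightarrow> complex" where
  "sol_minus k x = (ray 0 (cis (\<phi> k)) x - ray 0 (cis (- \<phi> k)) x) / (2 * \<i>)"

lemma finite_directions: "finite directions"
  using finite_P finite_Q by (simp add: directions_def)

lemma cis_in_directions:
  "k \<in> insert 0 (P \<union> Q) \<Longrightarrow> cis (\<phi> k) \<in> directions"
  "k \<in> insert 0 (P \<union> Q) \<Longrightarrow> cis (- \<phi> k) \<in> directions"
  by (auto simp: directions_def)

text \<open>\<open>F\<close> stays arbitrary: the constant 1 gives coefficient sum zero,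
  \<open>ray 0\<close> gives the solution itself, and indicator functions later separate the
  coefficients.\<close>

lemma sum_coeff_plus:
  assumes "k \<in> P"
  shows "(\<Sum>z\<in>directions. coeff_plus k z * F z)
           = F (cis (\<phi> 0)) - (F (cis (\<phi> k)) + F (cis (- \<phi> k))) / 2"
proof -
  have "(\<Sum>z\<in>directions. coeff_plus k z * F z)
      = (\<Sum>z\<in>directions. if z = cis (\<phi> 0) then F z else 0)
        - ((\<Sum>z\<in>directions. if z = cis (\<phi> k) then F z else 0)
           + (\<Sum>z\<in>directions. if z = cis (- \<phi> k) then F z else 0)) / 2"
    unfolding sum.distrib [symmetric] sum_subtractf [symmetric] sum_divide_distrib
    by (intro sum.cong) (auto simp: coeff_plus_def field_simps)
  then show ?thesis
    using assms finite_directions cis_in_directions[of 0] cis_in_directions[of k] by simp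
qed

lemma sum_coeff_minus:
  assumes "k \<in> Q"
  shows "(\<Sum>z\<in>directions. coeff_minus k z * F z) = (F (cis (\<phi> k)) - F (cis (- \<phi> k))) / (2 * \<i>)"
proof -
  have "(\<Sum>z\<in>directions. coeff_minus k z * F z)
      = ((\<Sum>z\<in>directions. if z = cis (\<phi> k) then F z else 0)
           - (\<Sum>z\<in>directions. if z = cis (- \<phi> k) then F z else 0)) / (2 * \<i>)"
    unfolding sum_subtractf [symmetric] sum_divide_distrib
    by (intro sum.cong) (auto simp: coeff_minus_def field_simps)
  then show ?thesis
    using assms finite_directions cis_in_directions[of k] by simp
qed

text \<open>The angle \<open>- \<phi> k\<close> gives the conjugate direction, and \<open>c\<close>
  and \<open>A\<close> are real, so conjugating \<open>direction\<close> covers it.\<close>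

lemma directions_power:
  assumes "z \<in> directions"
  shows "z ^ n * (- of_real c) ^ (n - 1) = of_real A"
proof -
  obtain k where "z = cis (\<phi> k) \<or> z = cnj (cis (\<phi> k))"
    using assms by (auto simp: directions_def cis_cnj)
  moreover have "cis (\<phi> k) ^ n * (- of_real c) ^ (n - 1) = of_real A"
    using direction[of k] by (subst Complex.DeMoivre)
  moreover from arg_cong[OF this, of cnj]
  have "cnj (cis (\<phi> k)) ^ n * (- of_real c) ^ (n - 1) = of_real A"
    by simp
  ultimately show ?thesis by auto
qed

lemma ode_solution_sol_plus:
  assumes "k \<in> P"
  shows "ode_solution n c (sol_plus k)"
proof -
  have "ode_solution n c (\<lambda>x. \<Sum>z\<in>directions. coeff_plus k z * ray 0 z x)"
    using sum_coeff_plus[OF assms, of "\<lambda>_. 1"]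
    by (intro ode_solution_sum_ray directions_power) auto
  then show ?thesis
    by (simp add: sum_coeff_plus[OF assms] sol_plus_def[abs_def])
qed

lemma ode_solution_sol_minus:
  assumes "k \<in> Q"
  shows "ode_solution n c (sol_minus k)"
proof -
  have "ode_solution n c (\<lambda>x. \<Sum>z\<in>directions. coeff_minus k z * ray 0 z x)"
    using sum_coeff_minus[OF assms, of "\<lambda>_. 1"]
    by (intro ode_solution_sum_ray directions_power) auto
  then show ?thesis
    by (simp add: sum_coeff_minus[OF assms] sol_minus_def[abs_def])
qed

lemma scalars_zero:
  assumes zero: "\<And>x. (\<Sum>k\<in>P. p k * sol_plus k x) + (\<Sum>k\<in>Q. q k * sol_minus k x) = 0"
  shows "k \<in> P \<Longrightarrow> p k = 0" "k \<in> Q \<Longrightarrow> q k = 0"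
proof -
  \<comment> \<open>The relation is rewritten with one coefficient per direction, so that
    independence of the rays applies.\<close>
  define v where "v z = (\<Sum>k\<in>P. p k * coeff_plus k z) + (\<Sum>k\<in>Q. q k * coeff_minus k z)" for z
  have v: "(\<Sum>z\<in>directions. v z * F z)
      = (\<Sum>k\<in>P. p k * (F (cis (\<phi> 0)) - (F (cis (\<phi> k)) + F (cis (- \<phi> k))) / 2))
        + (\<Sum>k\<in>Q. q k * ((F (cis (\<phi> k)) - F (cis (- \<phi> k))) / (2 * \<i>)))" for F
  proof -
    have "(\<Sum>z\<in>directions. v z * F z)
        = (\<Sum>k\<in>P. p k * (\<Sum>z\<in>directions. coeff_plus k z * F z))
          + (\<Sum>k\<in>Q. q k * (\<Sum>z\<in>directions. coeff_minus k z * F z))"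
      unfolding v_def sum_distrib_left distrib_right sum.distrib sum_distrib_right
      by (subst (1 2) sum.swap) (simp add: mult.assoc)
    then show ?thesis
      by (simp add: sum_coeff_plus sum_coeff_minus)
  qed
  have "v z = 0" if "z \<in> directions" for z
  proof (rule sum_ray_eq_0D[OF finite_directions _ _ that])
    show "0 \<notin> directions" by (auto simp: directions_def)
    show "(\<Sum>z\<in>directions. v z * ray 0 z x) = 0" for x
      using zero[of x] by (simp add: v sol_plus_def sol_minus_def)
  qed
  \<comment> \<open>As all \<open>v z\<close> vanish, the relation holds for any test function
    \<open>F\<close> on the directions.\<close>
  then have 0: "(\<Sum>k\<in>P. p k * (F (cis (\<phi> 0)) - (F (cis (\<phi> k)) + F (cis (- \<phi> k))) / 2))
        + (\<Sum>k\<in>Q. q k * ((F (cis (\<phi> k)) - F (cis (- \<phi> k))) / (2 * \<i>))) = 0" for F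
    using v[of F] by simp
  have cos_eq: "cos (\<phi> i) = cos (\<phi> j) \<longleftrightarrow> i = j"
    if "i \<in> insert 0 (P \<union> Q)" "j \<in> insert 0 (P \<union> Q)" for i j
    using cos_inj_pi[of "\<phi> i" "\<phi> j"] \<phi>_range[of i] \<phi>_range[of j] that inj_onD[OF inj_\<phi>, of i j]
    by auto
  show p0: "p k = 0" if k: "k \<in> P" for k
  proof -
    \<comment> \<open>A test function of \<open>Re z\<close> alone takes equal values at conjugate
      points, so the terms with \<open>q\<close> drop out. Cosine separates the angles, and
      \<open>k\<close> differs from the reference index 0.\<close>
    have "(\<Sum>i\<in>P. p i * (of_bool (cos (\<phi> 0) = cos (\<phi> k)) - of_bool (cos (\<phi> i) = cos (\<phi> k)))) = (0::complex)"
      using 0[of "\<lambda>z. of_bool (Re z = cos (\<phi> k))"] by simp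
    also have "(\<Sum>i\<in>P. p i * (of_bool (cos (\<phi> 0) = cos (\<phi> k)) - of_bool (cos (\<phi> i) = cos (\<phi> k))))
        = (\<Sum>i\<in>P. if i = k then - p i else 0)"
      using k pos_P by (intro sum.cong) (auto simp: cos_eq)
    finally show ?thesis using finite_P k by simp
  qed
  show "q k = 0" if k: "k \<in> Q" for k
  proof -
    \<comment> \<open>For indices in \<open>Q\<close> the angles lie strictly between 0 and pi, so
      \<open>cis (- \<phi> i)\<close> is in the lower half plane and \<open>cis (\<phi> k)\<close>
      in the upper.\<close>
    have eq: "cis (\<phi> i) = cis (\<phi> k) \<longleftrightarrow> i = k" "cis (- \<phi> i) \<noteq> cis (\<phi> k)" if "i \<in> Q" for i
    proof -
      show "cis (\<phi> i) = cis (\<phi> k) \<longleftrightarrow> i = k"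
        using cos_eq[of i k] that k by (metis Un_iff cis.sel(1) insertCI)
      have "0 < sin (\<phi> i)" "0 < sin (\<phi> k)"
        using \<phi>_interior[of i] \<phi>_interior[of k] that k by (auto intro: sin_gt_zero)
      then show "cis (- \<phi> i) \<noteq> cis (\<phi> k)"
        by (auto simp: complex_eq_iff)
    qed
    have "(\<Sum>i\<in>Q. q i * ((of_bool (cis (\<phi> i) = cis (\<phi> k)) - of_bool (cis (- \<phi> i) = cis (\<phi> k)))
        / (2 * \<i>))) = 0"
      using 0[of "\<lambda>z. of_bool (z = cis (\<phi> k))"] by (simp add: p0)
    also have "(\<Sum>i\<in>Q. q i * ((of_bool (cis (\<phi> i) = cis (\<phi> k)) - of_bool (cis (- \<phi> i) = cis (\<phi> k)))
        / (2 * \<i>))) = (\<Sum>i\<in>Q. if i = k then q i / (2 * \<i>) else 0)"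
      by (intro sum.cong) (auto simp: eq)
    finally show ?thesis using finite_Q k by simp
  qed
qed

lemma
  shows card_solutions: "card (sol_plus ` P \<union> sol_minus ` Q) = card P + card Q"
    and independent_solutions: "cfun.independent (sol_plus ` P \<union> sol_minus ` Q)"
proof -
  \<comment> \<open>The disjoint sum keeps the two families apart where they share indices, so
    injectivity of \<open>f\<close> also excludes coincidences between them.\<close>
  define f where "f = case_sum sol_plus sol_minus"
  have fin: "finite (P <+> Q)" using finite_P finite_Q by simp
  have im: "f ` (P <+> Q) = sol_plus ` P \<union> sol_minus ` Q"
    by (auto simp: f_def image_Un Plus_def image_image)
  have zero: "u i = 0" if "(\<Sum>i\<in>P <+> Q. (\<lambda>x. u i * f i x)) = 0" "i \<in> P <+> Q" for u i
  proof -
    have "(\<Sum>k\<in>P. u (Inl k) * sol_plus k x) + (\<Sum>k\<in>Q. u (Inr k) * sol_minus k x) = 0" for x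
      using fun_cong[OF that(1), of x] finite_P finite_Q
      by (simp add: sum_fun_apply sum.Plus f_def)
    from scalars_zero[OF this] show ?thesis using that(2) by auto
  qed
  have "inj_on f (P <+> Q)" "cfun.independent (f ` (P <+> Q))"
    by (rule cfun.independent_image_if_scalars_zero[OF fin], erule zero, assumption)+
  then show "card (sol_plus ` P \<union> sol_minus ` Q) = card P + card Q"
    "cfun.independent (sol_plus ` P \<union> sol_minus ` Q)"
    using finite_P finite_Q by (auto simp: card_image card_Plus simp flip: im)
qed

section \<open>The integrals of the theorem as combinations of rays\<close>

text \<open>The common shape of \<open>integrand1_plus\<close> and \<open>integrand2_plus\<close>;
  in the first case \<open>\<phi> 0 = 0\<close>, so the factor \<open>cis (\<phi> 0)\<close> is
  1.\<close>

definition integrand_plus :: "nat \<Rightarrow> complex \<Rightarrow> real \<Rightarrow> complex" where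
  "integrand_plus k x w = of_real (exp (- (A * (w ^ n / real n)))) *
     (cis (\<phi> 0) * exp (- (of_real (c * w) * x * cis (\<phi> 0)))
      - exp (- (of_real (c * w) * x * of_real (cos (\<phi> k))))
        * cos (of_real (c * w) * x * of_real (sin (\<phi> k)) - of_real (\<phi> k)))"

definition integrand_minus :: "nat \<Rightarrow> complex \<Rightarrow> real \<Rightarrow> complex" where
  "integrand_minus k x w =
     exp (- of_real (A * (w ^ n / real n)) - of_real (c * w) * x * of_real (cos (\<phi> k)))
     * sin (of_real (c * w) * x * of_real (sin (\<phi> k)) - of_real (\<phi> k))"

lemma ray_integrand_eq:
  "ray_integrand z x w
     = of_real (exp (- (A * (w ^ n / real n)))) * (z * exp (- (of_real (c * w) * x * z)))"
  by (simp add: ray_integrand_def kern_def mult_ac)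

lemma integrand_plus_eq:
  "integrand_plus k x = (\<lambda>w. ray_integrand (cis (\<phi> 0)) x w
     - (ray_integrand (cis (\<phi> k)) x w + ray_integrand (cis (- \<phi> k)) x w) / 2)"
  unfolding integrand_plus_def exp_mult_cos_eq ray_integrand_eq
  by (simp add: fun_eq_iff algebra_simps add_divide_distrib)

lemma integrand_minus_eq:
  "integrand_minus k x = (\<lambda>w. - ((ray_integrand (cis (\<phi> k)) x w
     - ray_integrand (cis (- \<phi> k)) x w) / (2 * \<i>)))"
proof
  fix w
  have "integrand_minus k x w = of_real (exp (- (A * (w ^ n / real n))))
     * (exp (- (of_real (c * w) * x * of_real (cos (\<phi> k))))
        * sin (of_real (c * w) * x * of_real (sin (\<phi> k)) - of_real (\<phi> k)))"
    by (simp add: integrand_minus_def exp_of_real [symmetric] exp_add [symmetric])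
  then show "integrand_minus k x w = - ((ray_integrand (cis (\<phi> k)) x w
     - ray_integrand (cis (- \<phi> k)) x w) / (2 * \<i>))"
    unfolding exp_mult_sin_eq ray_integrand_eq
    by (simp add: algebra_simps diff_divide_distrib)
qed

lemma set_integrable_integrand_plus: "set_integrable lborel {0..} (integrand_plus k x)"
  unfolding integrand_plus_eq
  by (intro set_integral_add set_integral_diff set_integrable_divide set_integrable_ray_integrand)

lemma set_integrable_integrand_minus: "set_integrable lborel {0..} (integrand_minus k x)"
  unfolding integrand_minus_eq
  using set_integrable_mult_right[of "-1" lborel "{0..}" "\<lambda>w. (ray_integrand (cis (\<phi> k)) x w
     - ray_integrand (cis (- \<phi> k)) x w) / (2 * \<i>)"]
  by auto

lemma integral_integrand_plus: "(LBINT w:{0..}. integrand_plus k x w) = sol_plus k x"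
  unfolding integrand_plus_eq sol_plus_def
  by (simp add: integral_ray_integrand set_integrable_ray_integrand)

lemma integral_integrand_minus: "- (LBINT w:{0..}. integrand_minus k x w) = sol_minus k x"
proof -
  have "(LBINT w:{0..}. - ((ray_integrand (cis (\<phi> k)) x w
      - ray_integrand (cis (- \<phi> k)) x w) / (2 * \<i>)))
      = - (LBINT w:{0..}. (ray_integrand (cis (\<phi> k)) x w
      - ray_integrand (cis (- \<phi> k)) x w) / (2 * \<i>))"
    by (intro set_integral_uminus set_integrable_divide set_integral_diff
        set_integrable_ray_integrand)
  then show ?thesis
    unfolding integrand_minus_eq sol_minus_def
    by (simp add: integral_ray_integrand set_integrable_ray_integrand)
qed

end

section \<open>The angles in the two cases: roots of 1 and roots of - 1\<close>

theorem theorem2p1: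
  fixes n :: nat and c :: real
  assumes "n \<ge> 2" and "c \<noteq> 0"
  shows
    "(odd n \<or> (even n \<and> c < 0) \<longrightarrow>
        (\<forall>k\<in>index1_plus n. \<forall>x. set_integrable lborel {0..} (integrand1_plus n c k x)) \<and>
        (\<forall>k\<in>index1_minus n. \<forall>x. set_integrable lborel {0..} (integrand1_minus n c k x)) \<and>
        (\<forall>y\<in>solutions1 n c. ode_solution n c y) \<and>
        card (solutions1 n c) = n - 1 \<and>
        cfun.independent (solutions1 n c)) \<and>
     (even n \<and> c > 0 \<longrightarrow>
        (\<forall>k\<in>index2_plus n. \<forall>x. set_integrable lborel {0..} (integrand2_plus n c k x)) \<and>
        (\<forall>k\<in>index2_minus n. \<forall>x. set_integrable lborel {0..} (integrand2_minus n c k x)) \<and>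
        (\<forall>y\<in>solutions2 n c. ode_solution n c y) \<and>
        card (solutions2 n c) = n - 1 \<and>
        cfun.independent (solutions2 n c))"
proof (intro conjI[of "_ \<longrightarrow> _"] impI)
  have n0: "real n > 0" using assms by simp
  {
    assume case1: "odd n \<or> (even n \<and> c < 0)"
    have P: "index1_plus n = {1..n div 2}" and Q: "index1_minus n = {1..(n - 1) div 2}"
      using assms by (auto simp: index1_plus_def index1_minus_def)
    interpret airy_ode_angles n "(- c) ^ (n - 1)" c "\<lambda>k. 2 * real k * pi / real n"
      "index1_plus n" "index1_minus n"
    proof
      \<comment> \<open>Either \<open>n - 1\<close> is even, or \<open>- c\<close> is
        positive.\<close>
      show "0 < (- c) ^ (n - 1)"
        using case1 assms by (auto simp: zero_less_power_eq)
      show "inj_on (\<lambda>k. 2 * real k * pi / real n) (insert 0 (index1_plus n \<union> index1_minus n))"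
        using n0 by (auto simp: inj_on_def)
      show "2 * real k * pi / real n \<in> {0..pi}"
        if "k \<in> insert 0 (index1_plus n \<union> index1_minus n)" for k
        using that n0 by (auto simp: index1_plus_def index1_minus_def divide_le_eq)
      show "2 * real k * pi / real n \<in> {0<..<pi}" if "k \<in> index1_minus n" for k
        using that n0 by (auto simp: index1_minus_def divide_less_eq)
      show "cis (real n * (2 * real k * pi / real n)) * (- complex_of_real c) ^ (n - 1)
          = complex_of_real ((- c) ^ (n - 1))" for k
        using n0 cis_multiple_2pi[of "real k"] by (simp add: mult_ac)
    qed (use assms in \<open>auto simp: P Q\<close>)
    have plus: "integrand1_plus n c = integrand_plus"
      by (intro ext, unfold integrand1_plus_def integrand_plus_def Let_def) (simp)
    have minus: "integrand1_minus n c = integrand_minus"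
      by (intro ext, unfold integrand1_minus_def integrand_minus_def Let_def) (simp)
    have sols: "solutions1 n c = sol_plus ` index1_plus n \<union> sol_minus ` index1_minus n"
      unfolding solutions1_def y1_plus_def[abs_def] y1_minus_def[abs_def] plus minus
        integral_integrand_plus integral_integrand_minus ..
    have card: "card (index1_plus n) + card (index1_minus n) = n - 1"
      using assms by (simp add: P Q)
    show "(\<forall>k\<in>index1_plus n. \<forall>x. set_integrable lborel {0..} (integrand1_plus n c k x)) \<and>
        (\<forall>k\<in>index1_minus n. \<forall>x. set_integrable lborel {0..} (integrand1_minus n c k x)) \<and>
        (\<forall>y\<in>solutions1 n c. ode_solution n c y) \<and>
        card (solutions1 n c) = n - 1 \<and>
        cfun.independent (solutions1 n c)"
      using card_solutions independent_solutions card
      by (auto simp: plus minus sols set_integrable_integrand_plus set_integrable_integrand_minus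
          intro: ode_solution_sol_plus ode_solution_sol_minus simp del: One_nat_def)
  next
    assume case2: "even n \<and> c > 0"
    \<comment> \<open>For even \<open>n\<close> the largest index is \<open>n / 2 - 1\<close>, so
      \<open>2 * k + 1\<close> is at most \<open>n - 1\<close> and every angle lies strictly below
      pi.\<close>
    have le: "2 * k + 1 < n" if "k \<in> insert 0 (index2_plus n \<union> index2_minus n)" for k
      using that case2 assms by (auto simp: index2_plus_def index2_minus_def elim!: evenE)
    interpret airy_ode_angles n "c ^ (n - 1)" c "\<lambda>k. (2 * real k + 1) * pi / real n"
      "index2_plus n" "index2_minus n"
    proof
      show "inj_on (\<lambda>k. (2 * real k + 1) * pi / real n) (insert 0 (index2_plus n \<union> index2_minus n))"
        using n0 by (auto simp: inj_on_def)
      have *: "(2 * real k + 1) * pi / real n \<in> {0<..<pi}"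
        if "k \<in> insert 0 (index2_plus n \<union> index2_minus n)" for k
      proof -
        have "2 * real k + 1 < real n" using le[OF that] by linarith
        then show ?thesis
          using n0 by (auto simp: divide_less_eq)
      qed
      show "(2 * real k + 1) * pi / real n \<in> {0..pi}"
        if "k \<in> insert 0 (index2_plus n \<union> index2_minus n)" for k
        using *[OF that] by simp
      show "(2 * real k + 1) * pi / real n \<in> {0<..<pi}" if "k \<in> index2_minus n" for k
        using * that by blast
      show "cis (real n * ((2 * real k + 1) * pi / real n)) * (- complex_of_real c) ^ (n - 1)
          = complex_of_real (c ^ (n - 1))" for k
      proof -
        have "real n * ((2 * real k + 1) * pi / real n) = 2 * pi * real k + pi"
          using n0 by (simp add: field_simps)
        then have "cis (real n * ((2 * real k + 1) * pi / real n)) = cis (2 * pi * real k) * cis pi"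
          by (simp only: cis_mult)
        also have "\<dots> = - 1"
          using cis_multiple_2pi[of "real k"] by simp
        \<comment> \<open>Since \<open>n - 1\<close> is odd, the sign of
          \<open>(- c) ^ (n - 1)\<close> cancels the factor - 1.\<close>
        finally show ?thesis
          using case2 assms by simp
      qed
    qed (use assms case2 in \<open>auto simp: index2_plus_def index2_minus_def\<close>)
    have plus: "integrand2_plus n c = integrand_plus"
      by (intro ext, unfold integrand2_plus_def integrand_plus_def Let_def) (simp add: cis_conv_exp)
    have minus: "integrand2_minus n c = integrand_minus"
      by (intro ext, unfold integrand2_minus_def integrand_minus_def Let_def) (simp)
    have sols: "solutions2 n c = sol_plus ` index2_plus n \<union> sol_minus ` index2_minus n"
      unfolding solutions2_def y2_plus_def[abs_def] y2_minus_def[abs_def] plus minus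
        integral_integrand_plus integral_integrand_minus ..
    have card: "card (index2_plus n) + card (index2_minus n) = n - 1"
      using assms case2 by (auto simp: index2_plus_def index2_minus_def elim!: evenE)
    show "(\<forall>k\<in>index2_plus n. \<forall>x. set_integrable lborel {0..} (integrand2_plus n c k x)) \<and>
        (\<forall>k\<in>index2_minus n. \<forall>x. set_integrable lborel {0..} (integrand2_minus n c k x)) \<and>
        (\<forall>y\<in>solutions2 n c. ode_solution n c y) \<and>
        card (solutions2 n c) = n - 1 \<and>
        cfun.independent (solutions2 n c)"
      using card_solutions independent_solutions card
      by (auto simp: plus minus sols set_integrable_integrand_plus set_integrable_integrand_minus
          intro: ode_solution_sol_plus ode_solution_sol_minus simp del: One_nat_def)
  }
qed

end
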